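(* Let $\mathcal C$ and $\mathcal C'$ be triangulated categories endowed with weight structures $w$ and $w'$, respectively, and let $F:\mathcal C\to\mathcal C'$ be a weight-exact functor. Assume that the induced functor between the hearts $\underline{Hw}\to\underline{Hw}'$ is full and conservative. Let $M$ be an object of $\mathcal C$ and $n\in\mathbb Z$. 1. Suppose that $M$ is $w$-bounded above (resp. $w$-bounded below). Then $F(M)$ belongs to $\mathcal C'_{w'\le n}$ (resp. to $\mathcal C'_{w'\ge n}$) if and only if $M$ belongs to $\mathcal C_{w\le n}$ (resp. to $\mathcal C_{w\ge n}$). 2. Assume that $M$ is $w$-bounded above (resp. below) and $F(M)=0$. Then $M$ is right (resp. left) $w$-degenerate. Moreover, if $M$ is $w$-bounded (and $F(M)=0$), then $M=0$. 3. Suppose that $M$ is $w$-bounded above, and assume that for any $i\in\mathbb Z$ such that $M\in\mathcal C_{w\le i}$ and any $N\in\mathcal C_{w=i}$ the homomorphism $\mathcal C(M,N)\to\mathcal C'(F(M),F(N))$ induced by $F$ is zero. Then $M$ is right $w$-degenerate.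
   Context: A weight structure $w$ on a triangulated category $\mathcal C$ (homological convention) is a pair of classes $\mathcal C_{w\le 0},\mathcal C_{w\ge 0}\subset \mathrm{Obj}\,\mathcal C$ such that: (i) both are closed under retracts in $\mathcal C$; (ii) $\mathcal C_{w\le 0}\subset\mathcal C_{w\le 0}[1]$ and $\mathcal C_{w\ge 0}[1]\subset\mathcal C_{w\ge 0}$; (iii) $\mathcal C(X,Y)=0$ for all $X\in\mathcal C_{w\le 0}$, $Y\in\mathcal C_{w\ge 0}[1]$; (iv) every $M\in\mathrm{Obj}\,\mathcal C$ fits in a distinguished triangle $LM\to M\to RM\to LM[1]$ with $LM\in\mathcal C_{w\le 0}$, $RM\in\mathcal C_{w\ge 0}[1]$. Notation: $\mathcal C_{w\ge i}=\mathcal C_{w\ge 0}[i]$, $\mathcal C_{w\le i}=\mathcal C_{w\le 0}[i]$, $\mathcal C_{w=i}=\mathcal C_{w\ge i}\cap\mathcal C_{w\le i}$. The heart $\underline{Hw}$ is the full subcategory of $\mathcal C$ with object class $\mathcal C_{w=0}$. An object is $w$-bounded above (resp. below) if it belongs to $\bigcup_i\mathcal C_{w\le i}$ (resp. $\bigcup_i\mathcal C_{w\ge i}$), and $w$-bounded if it is both. An object is left (resp. right) $w$-degenerate if it belongs to $\bigcap_i\mathcal C_{w\ge i}$ (resp. $\bigcap_i\mathcal C_{w\le i}$). An exact functor $F:\mathcal C\to\mathcal C'$ is weight-exact if $F(\mathcal C_{w\le 0})\subset\mathcal C'_{w'\le 0}$ and $F(\mathcal C_{w\ge 0})\subset\mathcal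 C'_{w'\ge 0}$. *)

theory Defs
  imports "HOL-Algebra.Group"
begin

section \<open>Categories and functors\<close>

record ('o, 'm) cat =
  Obj :: "'o set"
  Hom :: "'o \<Rightarrow> 'o \<Rightarrow> 'm set"
  Ident :: "'o \<Rightarrow> 'm"
  Cmp :: "'m \<Rightarrow> 'm \<Rightarrow> 'm"

text \<open>\<open>Cmp C g f\<close> is the composite ``\<open>g\<close> after \<open>f\<close>''. As Hom sets of different pairs of objects
  are disjoint, a morphism determines its source and target, so operations on morphisms need not
  be indexed by objects.\<close>

locale category =
  fixes C :: "('o, 'm, 'z) cat_scheme"
  assumes hom_obj: "f \<in> Hom C X Y \<Longrightarrow> X \<in> Obj C \<and> Y \<in> Obj C"
    and hom_disjoint: "f \<in> Hom C X Y \<Longrightarrow> f \<in> Hom C X' Y' \<Longrightarrow> X = X' \<and> Y = Y'"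
    and ident_in: "X \<in> Obj C \<Longrightarrow> Ident C X \<in> Hom C X X"
    and cmp_in: "f \<in> Hom C X Y \<Longrightarrow> g \<in> Hom C Y Z \<Longrightarrow> Cmp C g f \<in> Hom C X Z"
    and ident_left: "f \<in> Hom C X Y \<Longrightarrow> Cmp C (Ident C Y) f = f"
    and ident_right: "f \<in> Hom C X Y \<Longrightarrow> Cmp C f (Ident C X) = f"
    and cmp_assoc: "f \<in> Hom C X Y \<Longrightarrow> g \<in> Hom C Y Z \<Longrightarrow> h \<in> Hom C Z W \<Longrightarrow>
        Cmp C (Cmp C h g) f = Cmp C h (Cmp C g f)"

definition is_iso :: "('o, 'm, 'z) cat_scheme \<Rightarrow> 'o \<Rightarrow> 'o \<Rightarrow> 'm \<Rightarrow> bool" where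
  "is_iso C X Y f \<longleftrightarrow> f \<in> Hom C X Y \<and>
     (\<exists>g \<in> Hom C Y X. Cmp C g f = Ident C X \<and> Cmp C f g = Ident C Y)"

definition is_zero_object :: "('o, 'm, 'z) cat_scheme \<Rightarrow> 'o \<Rightarrow> bool" where
  "is_zero_object C Z \<longleftrightarrow> Z \<in> Obj C \<and>
     (\<forall>X \<in> Obj C. (\<exists>!f. f \<in> Hom C Z X) \<and> (\<exists>!f. f \<in> Hom C X Z))"

definition is_retract :: "('o, 'm, 'z) cat_scheme \<Rightarrow> 'o \<Rightarrow> 'o \<Rightarrow> bool" where
  "is_retract C Y X \<longleftrightarrow> (\<exists>i \<in> Hom C Y X. \<exists>p \<in> Hom C X Y. Cmp C p i = Ident C Y)"

definition retract_closed :: "('o, 'm, 'z) cat_scheme \<Rightarrow> 'o set \<Rightarrow> bool" where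
  "retract_closed C S \<longleftrightarrow> (\<forall>X \<in> S. \<forall>Y \<in> Obj C. is_retract C Y X \<longrightarrow> Y \<in> S)"

definition full_subcategory :: "('o, 'm, 'z) cat_scheme \<Rightarrow> 'o set \<Rightarrow> ('o, 'm) cat" where
  "full_subcategory C S =
     \<lparr>Obj = S,
      Hom = (\<lambda>X Y. if X \<in> S \<and> Y \<in> S then Hom C X Y else {}),
      Ident = Ident C,
      Cmp = Cmp C\<rparr>"

record ('o, 'm, 'p, 'q) func =
  fob :: "'o \<Rightarrow> 'p"
  far :: "'m \<Rightarrow> 'q"

locale cat_functor = source: category C + target: category D
  for C :: "('o, 'm, 'y) cat_scheme" and D :: "('p, 'q, 'z) cat_scheme" +
  fixes F :: "('o, 'm, 'p, 'q) func"
  assumes fob_in: "X \<in> Obj C \<Longrightarrow> fob F X \<in> Obj D"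
    and far_in: "f \<in> Hom C X Y \<Longrightarrow> far F f \<in> Hom D (fob F X) (fob F Y)"
    and far_ident: "X \<in> Obj C \<Longrightarrow> far F (Ident C X) = Ident D (fob F X)"
    and far_cmp: "f \<in> Hom C X Y \<Longrightarrow> g \<in> Hom C Y Z \<Longrightarrow>
        far F (Cmp C g f) = Cmp D (far F g) (far F f)"

definition full_functor ::
    "('o, 'm, 'y) cat_scheme \<Rightarrow> ('p, 'q, 'z) cat_scheme \<Rightarrow> ('o, 'm, 'p, 'q) func \<Rightarrow> bool" where
  "full_functor C D F \<longleftrightarrow>
     (\<forall>X \<in> Obj C. \<forall>Y \<in> Obj C. \<forall>g \<in> Hom D (fob F X) (fob F Y). \<exists>f \<in> Hom C X Y. far F f = g)"

definition conservative_functor ::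
    "('o, 'm, 'y) cat_scheme \<Rightarrow> ('p, 'q, 'z) cat_scheme \<Rightarrow> ('o, 'm, 'p, 'q) func \<Rightarrow> bool" where
  "conservative_functor C D F \<longleftrightarrow>
     (\<forall>X \<in> Obj C. \<forall>Y \<in> Obj C. \<forall>f \<in> Hom C X Y.
        is_iso D (fob F X) (fob F Y) (far F f) \<longrightarrow> is_iso C X Y f)"


section \<open>Additive categories\<close>

record ('o, 'm) addcat = "('o, 'm) cat" +
  Add :: "'m \<Rightarrow> 'm \<Rightarrow> 'm"
  Zero :: "'o \<Rightarrow> 'o \<Rightarrow> 'm"

text \<open>The additive groups of morphisms, as (multiplicatively written) groups of the library.\<close>

definition hom_group :: "('o, 'm, 'z) addcat_scheme \<Rightarrow> 'o \<Rightarrow> 'o \<Rightarrow> 'm monoid" where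
  "hom_group C X Y = \<lparr>carrier = Hom C X Y, monoid.mult = Add C, one = Zero C X Y\<rparr>"

definition Neg :: "('o, 'm, 'z) addcat_scheme \<Rightarrow> 'o \<Rightarrow> 'o \<Rightarrow> 'm \<Rightarrow> 'm" where
  "Neg C X Y f = inv\<^bsub>hom_group C X Y\<^esub> f"

locale additive_category = category C
  for C :: "('o, 'm, 'z) addcat_scheme" +
  assumes hom_comm_group: "X \<in> Obj C \<Longrightarrow> Y \<in> Obj C \<Longrightarrow> comm_group (hom_group C X Y)"
    and cmp_add_right: "f \<in> Hom C X Y \<Longrightarrow> f' \<in> Hom C X Y \<Longrightarrow> g \<in> Hom C Y Z \<Longrightarrow>
        Cmp C g (Add C f f') = Add C (Cmp C g f) (Cmp C g f')"
    and cmp_add_left: "f \<in> Hom C X Y \<Longrightarrow> g \<in> Hom C Y Z \<Longrightarrow> g' \<in> Hom C Y Z \<Longrightarrow>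
        Cmp C (Add C g g') f = Add C (Cmp C g f) (Cmp C g' f)"
    and zero_object_exists: "\<exists>Z. is_zero_object C Z"
    and biproduct_exists: "X \<in> Obj C \<Longrightarrow> Y \<in> Obj C \<Longrightarrow>
        \<exists>P \<in> Obj C. \<exists>i \<in> Hom C X P. \<exists>j \<in> Hom C Y P. \<exists>p \<in> Hom C P X. \<exists>q \<in> Hom C P Y.
          Cmp C p i = Ident C X \<and> Cmp C q j = Ident C Y \<and>
          Cmp C p j = Zero C Y X \<and> Cmp C q i = Zero C X Y \<and>
          Add C (Cmp C i p) (Cmp C j q) = Ident C P"

locale additive_functor =
  source: additive_category C + target: additive_category D + cat_functor C D F
  for C :: "('o, 'm, 'y) addcat_scheme" and D :: "('p, 'q, 'z) addcat_scheme"
    and F :: "('o, 'm, 'p, 'q) func" +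
  assumes far_add: "f \<in> Hom C X Y \<Longrightarrow> g \<in> Hom C X Y \<Longrightarrow>
        far F (Add C f g) = Add D (far F f) (far F g)"


section \<open>Triangulated categories\<close>

text \<open>\<open>(X, Y, Z, f, g, h) \<in> Dist C\<close> says that \<open>X \<rightarrow> Y \<rightarrow> Z \<rightarrow> X[1]\<close>, with morphisms \<open>f\<close>, \<open>g\<close>, \<open>h\<close>, is
  a distinguished triangle. \<open>Shift C\<close> is the functor \<open>[1]\<close>.\<close>

record ('o, 'm) tricat = "('o, 'm) addcat" +
  Shift :: "('o, 'm, 'o, 'm) func"
  Dist :: "('o \<times> 'o \<times> 'o \<times> 'm \<times> 'm \<times> 'm) set"

text \<open>The shift is an automorphism (not just an auto-equivalence) of the category, so that \<open>X[i]\<close>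
  is an actual object for every integer \<open>i\<close>.\<close>

locale triangulated_category = additive_category C
  for C :: "('o, 'm, 'z) tricat_scheme" +
  assumes shift_additive: "additive_functor C C (Shift C)"
    and shift_bij_obj: "bij_betw (fob (Shift C)) (Obj C) (Obj C)"
    and shift_bij_hom: "X \<in> Obj C \<Longrightarrow> Y \<in> Obj C \<Longrightarrow>
        bij_betw (far (Shift C)) (Hom C X Y) (Hom C (fob (Shift C) X) (fob (Shift C) Y))"
    and dist_typed: "(X, Y, Z, f, g, h) \<in> Dist C \<Longrightarrow>
        f \<in> Hom C X Y \<and> g \<in> Hom C Y Z \<and> h \<in> Hom C Z (fob (Shift C) X)"
    and TR1_iso: "(X, Y, Z, f, g, h) \<in> Dist C \<Longrightarrow>
        f' \<in> Hom C X' Y' \<Longrightarrow> g' \<in> Hom C Y' Z' \<Longrightarrow> h' \<in> Hom C Z' (fob (Shift C) X') \<Longrightarrow>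
        is_iso C X X' a \<Longrightarrow> is_iso C Y Y' b \<Longrightarrow> is_iso C Z Z' c \<Longrightarrow>
        Cmp C b f = Cmp C f' a \<Longrightarrow> Cmp C c g = Cmp C g' b \<Longrightarrow>
        Cmp C (far (Shift C) a) h = Cmp C h' c \<Longrightarrow>
        (X', Y', Z', f', g', h') \<in> Dist C"
    and TR1_ident: "X \<in> Obj C \<Longrightarrow> is_zero_object C Z \<Longrightarrow>
        (X, X, Z, Ident C X, Zero C X Z, Zero C Z (fob (Shift C) X)) \<in> Dist C"
    and TR1_cone: "f \<in> Hom C X Y \<Longrightarrow> \<exists>Z g h. (X, Y, Z, f, g, h) \<in> Dist C"
    and TR2: "f \<in> Hom C X Y \<Longrightarrow> g \<in> Hom C Y Z \<Longrightarrow> h \<in> Hom C Z (fob (Shift C) X) \<Longrightarrow>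
        (X, Y, Z, f, g, h) \<in> Dist C \<longleftrightarrow>
        (Y, Z, fob (Shift C) X, g, h,
          Neg C (fob (Shift C) X) (fob (Shift C) Y) (far (Shift C) f)) \<in> Dist C"
    and TR3: "(X, Y, Z, f, g, h) \<in> Dist C \<Longrightarrow> (X', Y', Z', f', g', h') \<in> Dist C \<Longrightarrow>
        a \<in> Hom C X X' \<Longrightarrow> b \<in> Hom C Y Y' \<Longrightarrow> Cmp C b f = Cmp C f' a \<Longrightarrow>
        \<exists>c \<in> Hom C Z Z'. Cmp C c g = Cmp C g' b \<and> Cmp C (far (Shift C) a) h = Cmp C h' c"
    and TR4: "(X, Y, Z', f, i, i') \<in> Dist C \<Longrightarrow> (Y, Z, X', g, j, j') \<in> Dist C \<Longrightarrow>
        (X, Z, Y', Cmp C g f, k, k') \<in> Dist C \<Longrightarrow>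
        \<exists>u \<in> Hom C Z' Y'. \<exists>v \<in> Hom C Y' X'.
          (Z', Y', X', u, v, Cmp C (far (Shift C) i) j') \<in> Dist C \<and>
          Cmp C u i = Cmp C k g \<and> Cmp C k' u = i' \<and>
          Cmp C v k = j \<and> Cmp C j' v = Cmp C (far (Shift C) f) k'"

definition shift_obj :: "('o, 'm, 'z) tricat_scheme \<Rightarrow> int \<Rightarrow> 'o \<Rightarrow> 'o" where
  "shift_obj C i X =
     (if i \<ge> 0 then (fob (Shift C) ^^ nat i) X
      else (inv_into (Obj C) (fob (Shift C)) ^^ nat (- i)) X)"

text \<open>An exact functor comes with a natural isomorphism \<open>\<eta> : F \<circ> [1] \<rightarrow> [1] \<circ> F\<close>.\<close>

locale exact_functor =
  source: triangulated_category C + target: triangulated_category D + additive_functor C D F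
  for C :: "('o, 'm, 'y) tricat_scheme" and D :: "('p, 'q, 'z) tricat_scheme"
    and F :: "('o, 'm, 'p, 'q) func" +
  fixes \<eta> :: "'o \<Rightarrow> 'q"
  assumes \<eta>_iso: "X \<in> Obj C \<Longrightarrow>
        is_iso D (fob F (fob (Shift C) X)) (fob (Shift D) (fob F X)) (\<eta> X)"
    and \<eta>_natural: "f \<in> Hom C X Y \<Longrightarrow>
        Cmp D (\<eta> Y) (far F (far (Shift C) f)) = Cmp D (far (Shift D) (far F f)) (\<eta> X)"
    and dist_image: "(X, Y, Z, f, g, h) \<in> Dist C \<Longrightarrow>
        (fob F X, fob F Y, fob F Z, far F f, far F g, Cmp D (\<eta> X) (far F h)) \<in> Dist D"


section \<open>Weight structures\<close>

record 'o weight =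
  wle0 :: "'o set"
  wge0 :: "'o set"

definition wle :: "('o, 'm, 'z) tricat_scheme \<Rightarrow> 'o weight \<Rightarrow> int \<Rightarrow> 'o set" where
  "wle C w i = shift_obj C i ` wle0 w"

definition wge :: "('o, 'm, 'z) tricat_scheme \<Rightarrow> 'o weight \<Rightarrow> int \<Rightarrow> 'o set" where
  "wge C w i = shift_obj C i ` wge0 w"

definition weq :: "('o, 'm, 'z) tricat_scheme \<Rightarrow> 'o weight \<Rightarrow> int \<Rightarrow> 'o set" where
  "weq C w i = wge C w i \<inter> wle C w i"

locale weight_structure = triangulated_category C
  for C :: "('o, 'm, 'z) tricat_scheme" +
  fixes w :: "'o weight"
  assumes wle0_obj: "wle0 w \<subseteq> Obj C"
    and wge0_obj: "wge0 w \<subseteq> Obj C"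
    and wle0_retract_closed: "retract_closed C (wle0 w)"
    and wge0_retract_closed: "retract_closed C (wge0 w)"
    and wle0_shift: "wle0 w \<subseteq> wle C w 1"
    and wge0_shift: "wge C w 1 \<subseteq> wge0 w"
    and orthogonality: "X \<in> wle0 w \<Longrightarrow> Y \<in> wge C w 1 \<Longrightarrow> Hom C X Y = {Zero C X Y}"
    and weight_decomposition: "M \<in> Obj C \<Longrightarrow>
        \<exists>LM \<in> wle0 w. \<exists>RM \<in> wge C w 1. \<exists>f g h. (LM, M, RM, f, g, h) \<in> Dist C"

definition heart :: "('o, 'm, 'z) tricat_scheme \<Rightarrow> 'o weight \<Rightarrow> ('o, 'm) cat" where
  "heart C w = full_subcategory C (weq C w 0)"

definition bounded_above :: "('o, 'm, 'z) tricat_scheme \<Rightarrow> 'o weight \<Rightarrow> 'o \<Rightarrow> bool" where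
  "bounded_above C w M \<longleftrightarrow> M \<in> (\<Union>i. wle C w i)"

definition bounded_below :: "('o, 'm, 'z) tricat_scheme \<Rightarrow> 'o weight \<Rightarrow> 'o \<Rightarrow> bool" where
  "bounded_below C w M \<longleftrightarrow> M \<in> (\<Union>i. wge C w i)"

definition w_bounded :: "('o, 'm, 'z) tricat_scheme \<Rightarrow> 'o weight \<Rightarrow> 'o \<Rightarrow> bool" where
  "w_bounded C w M \<longleftrightarrow> bounded_above C w M \<and> bounded_below C w M"

definition left_degenerate :: "('o, 'm, 'z) tricat_scheme \<Rightarrow> 'o weight \<Rightarrow> 'o \<Rightarrow> bool" where
  "left_degenerate C w M \<longleftrightarrow> M \<in> (\<Inter>i. wge C w i)"

definition right_degenerate :: "('o, 'm, 'z) tricat_scheme \<Rightarrow> 'o weight \<Rightarrow> 'o \<Rightarrow> bool" where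
  "right_degenerate C w M \<longleftrightarrow> M \<in> (\<Inter>i. wle C w i)"

locale weight_exact_functor =
  exact_functor C D F \<eta> + source: weight_structure C w + target: weight_structure D w'
  for C :: "('o, 'm, 'y) tricat_scheme" and w :: "'o weight"
    and D :: "('p, 'q, 'z) tricat_scheme" and w' :: "'p weight"
    and F :: "('o, 'm, 'p, 'q) func" and \<eta> :: "'o \<Rightarrow> 'q" +
  assumes wle0_image: "fob F ` wle0 w \<subseteq> wle0 w'"
    and wge0_image: "fob F ` wge0 w \<subseteq> wge0 w'"

end

theory Submission
  imports Defs
begin

text \<open>
  Let \<open>M\<close> have weights at most \<open>i\<close> and suppose that \<open>F\<close> kills all morphisms from \<open>M\<close> to
  \<open>C\<^bsub>w=i\<^esub>\<close>. In a weight decomposition \<open>L \<rightarrow> M \<rightarrow> R \<rightarrow> L[1]\<close> with \<open>L\<close> of weights at most \<open>i - 1\<close>,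
  the object \<open>R\<close> has weight exactly \<open>i\<close>, so \<open>F(M) \<rightarrow> F(R)\<close> is zero and \<open>F(R) \<rightarrow> F(L[1])\<close> is a split
  monomorphism. By orthogonality its retraction factors through \<open>F(R')\<close>, where \<open>L[1] \<rightarrow> R'\<close> comes from a
  weight decomposition of \<open>L[1]\<close> and \<open>R'\<close> also has weight \<open>i\<close>. Thus \<open>R \<rightarrow> R'\<close> becomes a split
  monomorphism under \<open>F\<close>; as \<open>F\<close> is full and conservative on objects of weight \<open>i\<close>, it is one already,
  and so is \<open>R \<rightarrow> L[1]\<close>. Hence \<open>M \<rightarrow> R\<close> is zero, \<open>M\<close> is a retract of \<open>L\<close>, and \<open>M\<close> has weights at
  most \<open>i - 1\<close>. Descending induction on \<open>i\<close> and the dual argument give all the claims.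
\<close>

text \<open>The axioms of a weight structure speak of level 0 only. Since the shift is invertible,
  levels \<open>i\<close> and \<open>i + 1\<close> are equivalent for the properties concerned, and
  one equivalence serves the upward and the downward induction.\<close>

lemma int_bi_induct:
  fixes k :: int
  assumes "P k" and "\<And>i. P i \<longleftrightarrow> P (i + 1)"
  shows "P i"
proof (induction i rule: int_induct [where k = k])
  case (step2 i)
  with assms(2) [of "i - 1"] show ?case by simp
qed (use assms in auto)

section \<open>Additive categories\<close>

context category
begin

lemma is_iso_retract:
  assumes "is_iso C X Y f"
  shows "is_retract C X Y" and "is_retract C Y X"
  using assms unfolding is_iso_def is_retract_def by blast+

lemma is_iso_cancel_left:
  assumes "is_iso C Y Z e" "f \<in> Hom C X Y" "g \<in> Hom C X Y" "Cmp C e f = Cmp C e g"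
  shows "f = g"
proof -
  obtain e' where "e \<in> Hom C Y Z" "e' \<in> Hom C Z Y" "Cmp C e' e = Ident C Y"
    using assms(1) unfolding is_iso_def by blast
  then show ?thesis
    using assms(2-4) cmp_assoc [of f X Y e Z e' Y] cmp_assoc [of g X Y e Z e' Y]
    by (simp add: ident_left)
qed

lemma is_iso_cancel_right:
  assumes "is_iso C X Y e" "f \<in> Hom C Y Z" "g \<in> Hom C Y Z" "Cmp C f e = Cmp C g e"
  shows "f = g"
proof -
  obtain e' where "e \<in> Hom C X Y" "e' \<in> Hom C Y X" "Cmp C e e' = Ident C Y"
    using assms(1) unfolding is_iso_def by blast
  then show ?thesis
    using assms(2-4) cmp_assoc [of e' Y X e Y f Z] cmp_assoc [of e' Y X e Y g Z]
    by (metis ident_right)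
qed

lemma is_iso_ident: "X \<in> Obj C \<Longrightarrow> is_iso C X X (Ident C X)"
  unfolding is_iso_def using ident_in ident_left by blast

end

context additive_category
begin

lemma zero_in: "X \<in> Obj C \<Longrightarrow> Y \<in> Obj C \<Longrightarrow> Zero C X Y \<in> Hom C X Y"
  using hom_comm_group [of X Y] monoid.one_closed [of "hom_group C X Y"]
  by (simp add: hom_group_def comm_group_def group_def)

lemma hom_group_at:
  assumes "f \<in> Hom C X Y"
  shows "group (hom_group C X Y)"
  using hom_comm_group hom_obj [OF assms] by (simp add: comm_group_def)

text \<open>Cancellation in the group of morphisms. It turns additivity into preservation of zero,
  both for composition and for additive functors.\<close>

lemma eq_zero_if_idem:
  assumes "f \<in> Hom C X Y" "Add C f f = f"
  shows "f = Zero C X Y"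
  using group.l_cancel_one [OF hom_group_at [OF assms(1)], of f f] assms
  by (simp add: hom_group_def)

lemma add_zero:
  assumes "f \<in> Hom C X Y"
  shows "Add C f (Zero C X Y) = f"
  using monoid.r_one [OF group.is_monoid [OF hom_group_at [OF assms]], of f] assms
  by (simp add: hom_group_def)

lemma neg_in:
  assumes "f \<in> Hom C X Y"
  shows "Neg C X Y f \<in> Hom C X Y"
  using group.inv_closed [OF hom_group_at [OF assms], of f] assms
  by (simp add: hom_group_def Neg_def)

lemma add_neg:
  assumes "f \<in> Hom C X Y"
  shows "Add C (Neg C X Y f) f = Zero C X Y"
  using group.l_inv [OF hom_group_at [OF assms], of f] assms
  by (simp add: hom_group_def Neg_def)

lemma neg_unique:
  assumes "f \<in> Hom C X Y" "g \<in> Hom C X Y" "Add C g f = Zero C X Y"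
  shows "Neg C X Y f = g"
  using group.inv_equality [OF hom_group_at [OF assms(1)], of g f] assms
  by (simp add: hom_group_def Neg_def)

lemma neg_neg:
  assumes "f \<in> Hom C X Y"
  shows "Neg C X Y (Neg C X Y f) = f"
  using group.inv_inv [OF hom_group_at [OF assms], of f] assms
  by (simp add: hom_group_def Neg_def)

lemma cmp_zero_right:
  assumes "X \<in> Obj C" "g \<in> Hom C Y Z"
  shows "Cmp C g (Zero C X Y) = Zero C X Z"
proof -
  have z: "Zero C X Y \<in> Hom C X Y" using zero_in assms hom_obj by blast
  show ?thesis
    using eq_zero_if_idem [OF cmp_in [OF z assms(2)]] cmp_add_right [OF z z assms(2)] add_zero [OF z]
    by simp
qed

lemma cmp_zero_left:
  assumes "f \<in> Hom C X Y" "Z \<in> Obj C"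
  shows "Cmp C (Zero C Y Z) f = Zero C X Z"
proof -
  have z: "Zero C Y Z \<in> Hom C Y Z" using zero_in assms hom_obj by blast
  show ?thesis
    using eq_zero_if_idem [OF cmp_in [OF assms(1) z]] cmp_add_left [OF assms(1) z z] add_zero [OF z]
    by simp
qed

lemma cmp_neg_right:
  assumes f: "f \<in> Hom C X Y" and g: "g \<in> Hom C Y Z"
  shows "Cmp C g (Neg C X Y f) = Neg C X Z (Cmp C g f)"
proof (rule neg_unique [symmetric])
  show "Add C (Cmp C g (Neg C X Y f)) (Cmp C g f) = Zero C X Z"
    using cmp_add_right [OF neg_in [OF f] f g] add_neg [OF f] cmp_zero_right [OF _ g] hom_obj [OF f]
    by simp
qed (use assms cmp_in neg_in in blast)+

lemma cmp_neg_left: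
  assumes f: "f \<in> Hom C X Y" and g: "g \<in> Hom C Y Z"
  shows "Cmp C (Neg C Y Z g) f = Neg C X Z (Cmp C g f)"
proof (rule neg_unique [symmetric])
  show "Add C (Cmp C (Neg C Y Z g) f) (Cmp C g f) = Zero C X Z"
    using cmp_add_left [OF f neg_in [OF g] g] add_neg [OF g] cmp_zero_left [OF f] hom_obj [OF g]
    by simp
qed (use assms cmp_in neg_in in blast)+

lemma neg_zero:
  assumes "X \<in> Obj C" "Y \<in> Obj C"
  shows "Neg C X Y (Zero C X Y) = Zero C X Y"
  using neg_unique add_zero zero_in [OF assms] by blast

lemma neg_eq_zero_iff:
  assumes "f \<in> Hom C X Y"
  shows "Neg C X Y f = Zero C X Y \<longleftrightarrow> f = Zero C X Y"
  using neg_zero neg_neg [OF assms] hom_obj [OF assms] by metis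

text \<open>Every morphism into or out of \<open>X\<close> is its own composite with the identity of
  \<open>X\<close>, so it vanishes if that identity does. The equational form is preserved by
  additive functors.\<close>

lemma is_zero_object_iff:
  assumes "X \<in> Obj C"
  shows "is_zero_object C X \<longleftrightarrow> Ident C X = Zero C X X"
proof
  assume "is_zero_object C X"
  then show "Ident C X = Zero C X X"
    using assms ident_in zero_in unfolding is_zero_object_def by blast
next
  assume *: "Ident C X = Zero C X X"
  have "f = Zero C X Y" if "f \<in> Hom C X Y" for f Y
    using ident_right [OF that] cmp_zero_right [OF assms that] * by simp
  moreover have "f = Zero C Y X" if "f \<in> Hom C Y X" for f Y
    using ident_left [OF that] cmp_zero_left [OF that assms] * by simp
  ultimately show "is_zero_object C X"
    unfolding is_zero_object_def using assms zero_in by blast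
qed

end

lemma (in additive_functor) far_zero:
  assumes "X \<in> Obj C" "Y \<in> Obj C"
  shows "far F (Zero C X Y) = Zero D (fob F X) (fob F Y)"
proof -
  have z: "Zero C X Y \<in> Hom C X Y" using source.zero_in assms by blast
  show ?thesis
    using target.eq_zero_if_idem [OF far_in [OF z]] far_add [OF z z] source.add_zero [OF z] by simp
qed

section \<open>Distinguished triangles\<close>

context triangulated_category
begin

abbreviation sob :: "'o \<Rightarrow> 'o" where "sob \<equiv> fob (Shift C)"
abbreviation sar :: "'m \<Rightarrow> 'm" where "sar \<equiv> far (Shift C)"

sublocale shift: additive_functor C C "Shift C"
  by (rule shift_additive)

lemma shift_surj_hom:
  assumes "g \<in> Hom C (sob X) (sob Y)" "X \<in> Obj C" "Y \<in> Obj C"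
  obtains f where "f \<in> Hom C X Y" "g = sar f"
  using shift_bij_hom [OF assms(2,3)] assms(1) unfolding bij_betw_def by blast

lemma shift_faithful:
  assumes "f \<in> Hom C X Y" "g \<in> Hom C X Y" "sar f = sar g"
  shows "f = g"
  using shift_bij_hom [of X Y] hom_obj [OF assms(1)] assms unfolding bij_betw_def inj_on_def by blast

lemma shift_inj_obj: "inj_on sob (Obj C)"
  using shift_bij_obj unfolding bij_betw_def by blast

lemma shift_image_subset_iff:
  assumes "A \<subseteq> Obj C" "B \<subseteq> Obj C"
  shows "sob ` A \<subseteq> sob ` B \<longleftrightarrow> A \<subseteq> B"
  using inj_on_image_mem_iff [OF shift_inj_obj _ assms(2)] assms(1) by blast

lemma shift_surj_obj:
  assumes "Y \<in> Obj C"
  obtains X where "X \<in> Obj C" "Y = sob X"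
  using shift_bij_obj assms unfolding bij_betw_def by blast

lemma is_zero_object_shift:
  assumes "is_zero_object C X"
  shows "is_zero_object C (sob X)"
proof -
  have X: "X \<in> Obj C" using assms unfolding is_zero_object_def by blast
  show ?thesis
    using assms is_zero_object_iff [OF X] is_zero_object_iff [OF shift.fob_in [OF X]]
      shift.far_zero [OF X X] shift.far_ident [OF X] by metis
qed

lemma is_iso_shift_iff:
  assumes f: "f \<in> Hom C X Y"
  shows "is_iso C (sob X) (sob Y) (sar f) \<longleftrightarrow> is_iso C X Y f"
proof -
  have ob: "X \<in> Obj C" "Y \<in> Obj C" using hom_obj [OF f] by auto
  have eq: "Cmp C (sar g) (sar f) = Ident C (sob X) \<longleftrightarrow> Cmp C g f = Ident C X"
    "Cmp C (sar f) (sar g) = Ident C (sob Y) \<longleftrightarrow> Cmp C f g = Ident C Y"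
    if g: "g \<in> Hom C Y X" for g
    using shift_faithful [OF cmp_in [OF f g] ident_in] shift_faithful [OF cmp_in [OF g f] ident_in]
      shift.far_cmp [OF f g] shift.far_cmp [OF g f] shift.far_ident ob by metis+
  have "Hom C (sob Y) (sob X) = sar ` Hom C Y X"
    using shift_bij_hom [OF ob(2,1)] unfolding bij_betw_def by blast
  then have "(\<exists>g \<in> Hom C (sob Y) (sob X). P g) \<longleftrightarrow> (\<exists>g \<in> Hom C Y X. P (sar g))" for P
    by simp
  then show ?thesis
    unfolding is_iso_def using f shift.far_in [OF f] eq by simp
qed

lemma is_retract_shift:
  assumes "is_retract C (sob X) (sob Y)" "X \<in> Obj C" "Y \<in> Obj C"
  shows "is_retract C X Y"
proof -
  obtain i p where ip: "i \<in> Hom C (sob X) (sob Y)" "p \<in> Hom C (sob Y) (sob X)"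
    "Cmp C p i = Ident C (sob X)"
    using assms(1) unfolding is_retract_def by blast
  obtain i' where i': "i' \<in> Hom C X Y" "i = sar i'" using shift_surj_hom ip(1) assms(2,3) by blast
  obtain p' where p': "p' \<in> Hom C Y X" "p = sar p'" using shift_surj_hom ip(2) assms(2,3) by blast
  have "sar (Cmp C p' i') = sar (Ident C X)"
    using ip i' p' shift.far_cmp shift.far_ident assms by metis
  then have "Cmp C p' i' = Ident C X"
    using shift_faithful [OF cmp_in [OF i'(1) p'(1)] ident_in] assms by blast
  then show ?thesis unfolding is_retract_def using i' p' by blast
qed

lemma is_retract_shiftI:
  assumes "is_retract C X Y"
  shows "is_retract C (sob X) (sob Y)"
proof -
  obtain i p where ip: "i \<in> Hom C X Y" "p \<in> Hom C Y X" "Cmp C p i = Ident C X"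
    using assms unfolding is_retract_def by blast
  then have "Cmp C (sar p) (sar i) = Ident C (sob X)"
    using shift.far_cmp [OF ip(1,2)] shift.far_ident hom_obj [OF ip(1)] by metis
  then show ?thesis unfolding is_retract_def using ip shift.far_in by blast
qed

section \<open>Exactness properties of distinguished triangles\<close>

lemma dist_rotate:
  assumes "(X, Y, Z, f, g, h) \<in> Dist C"
  shows "(Y, Z, sob X, g, h, Neg C (sob X) (sob Y) (sar f)) \<in> Dist C"
  using assms TR2 dist_typed by blast

text \<open>Obtained by undoing a rotation of \<open>TR1_ident\<close>. The zero object there is
  taken of the form \<open>sob Z\<close>, as \<open>TR2\<close> requires, and the sign disappears
  because the morphism it affects is zero.\<close>

lemma dist_ident_left:
  assumes W: "W \<in> Obj C"
  shows "\<exists>Z. is_zero_object C Z \<and> (Z, W, W, Zero C Z W, Ident C W, Zero C W (sob Z)) \<in> Dist C"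
proof -
  obtain Z where Z: "is_zero_object C Z" using zero_object_exists by blast
  then have Zo: "Z \<in> Obj C" unfolding is_zero_object_def by blast
  have "Neg C (sob Z) (sob W) (sar (Zero C Z W)) = Zero C (sob Z) (sob W)"
    using shift.far_zero [OF Zo W] neg_zero shift.fob_in Zo W by simp
  then show ?thesis
    using TR2 [of "Zero C Z W" Z W "Ident C W" W "Zero C W (sob Z)"]
      TR1_ident [OF W is_zero_object_shift [OF Z]] zero_in ident_in shift.fob_in Zo W Z by auto
qed

text \<open>By \<open>TR3\<close>, the identity of \<open>X\<close> and \<open>f\<close> extend to a
  morphism from the triangle X = X -> 0 to the given one, so the composite factors through a zero
  object.\<close>

lemma dist_cmp_zero:
  assumes d: "(X, Y, Z, f, g, h) \<in> Dist C"
  shows "Cmp C g f = Zero C X Z"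
proof -
  have t: "f \<in> Hom C X Y" "g \<in> Hom C Y Z" "h \<in> Hom C Z (sob X)" using dist_typed [OF d] by auto
  obtain O' where O: "is_zero_object C O'" using zero_object_exists by blast
  then have Oo: "O' \<in> Obj C" unfolding is_zero_object_def by blast
  have X: "X \<in> Obj C" using hom_obj [OF t(1)] by blast
  obtain c where "c \<in> Hom C O' Z" "Cmp C c (Zero C X O') = Cmp C g f"
    using TR3 [OF TR1_ident [OF X O] d ident_in [OF X] t(1)] by blast
  then show ?thesis using cmp_zero_right [OF X] by metis
qed

text \<open>Exactness of Hom(W, -) at \<open>Y\<close>. \<open>TR3\<close> supplies only the third
  component of a morphism of triangles, so W = W -> 0 and the given triangle are both rotated, which
  makes the wanted morphism, shifted, the third one.\<close>

lemma dist_lift: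
  assumes d: "(X, Y, Z, f, g, h) \<in> Dist C" and a: "a \<in> Hom C W Y" and 0: "Cmp C g a = Zero C W Z"
  shows "\<exists>b \<in> Hom C W X. Cmp C f b = a"
proof -
  have t: "f \<in> Hom C X Y" "g \<in> Hom C Y Z" "h \<in> Hom C Z (sob X)" using dist_typed [OF d] by auto
  have ob: "X \<in> Obj C" "Y \<in> Obj C" "Z \<in> Obj C" "W \<in> Obj C"
    using hom_obj [OF t(1)] hom_obj [OF t(2)] hom_obj [OF a] by auto
  obtain O' where O: "is_zero_object C O'" using zero_object_exists by blast
  then have Oo: "O' \<in> Obj C" unfolding is_zero_object_def by blast
  have "Cmp C (Zero C O' Z) (Zero C W O') = Cmp C g a"
    using 0 cmp_zero_right [OF ob(4) zero_in [OF Oo ob(3)]] by simp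
  then obtain c where c: "c \<in> Hom C (sob W) (sob X)"
    "Cmp C (sar a) (Neg C (sob W) (sob W) (sar (Ident C W))) =
     Cmp C (Neg C (sob X) (sob Y) (sar f)) c"
    using TR3 [OF dist_rotate [OF TR1_ident [OF ob(4) O]] dist_rotate [OF d] a zero_in [OF Oo ob(3)]]
    by metis
  obtain b where b: "b \<in> Hom C W X" "c = sar b" using shift_surj_hom c(1) ob by blast
  \<comment> \<open>Each rotation contributes one sign, on opposite sides of the equation, so the
    signs cancel.\<close>
  have "Neg C (sob W) (sob Y) (sar a) = Neg C (sob W) (sob Y) (sar (Cmp C f b))"
    using c(2) b cmp_neg_right [OF ident_in [OF shift.fob_in [OF ob(4)]] shift.far_in [OF a]]
      cmp_neg_left [OF c(1) shift.far_in [OF t(1)]] shift.far_ident [OF ob(4)]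
      ident_right [OF shift.far_in [OF a]] shift.far_cmp [OF b(1) t(1)] by simp
  then have "sar a = sar (Cmp C f b)"
    using neg_neg shift.far_in a cmp_in [OF b(1) t(1)] by metis
  then have "Cmp C f b = a"
    using shift_faithful [OF a cmp_in [OF b(1) t(1)]] by simp
  then show ?thesis using b by blast
qed

text \<open>Exactness of Hom(-, W) at \<open>Y\<close>. Against the triangle 0 -> W = W the wanted
  morphism is already the third component, so \<open>TR3\<close> applies without rotation.\<close>

lemma dist_extend:
  assumes d: "(X, Y, Z, f, g, h) \<in> Dist C" and a: "a \<in> Hom C Y W" and 0: "Cmp C a f = Zero C X W"
  shows "\<exists>b \<in> Hom C Z W. Cmp C b g = a"
proof -
  have t: "f \<in> Hom C X Y" "g \<in> Hom C Y Z" "h \<in> Hom C Z (sob X)" using dist_typed [OF d] by auto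
  have ob: "X \<in> Obj C" "W \<in> Obj C" using hom_obj [OF t(1)] hom_obj [OF a] by auto
  obtain O' where O: "is_zero_object C O'"
      "(O', W, W, Zero C O' W, Ident C W, Zero C W (sob O')) \<in> Dist C"
    using dist_ident_left [OF ob(2)] by blast
  then have Oo: "O' \<in> Obj C" unfolding is_zero_object_def by blast
  have "Cmp C a f = Cmp C (Zero C O' W) (Zero C X O')"
    using 0 cmp_zero_right [OF ob(1) zero_in [OF Oo ob(2)]] by simp
  then show ?thesis
    using TR3 [OF d O(2) zero_in [OF ob(1) Oo] a] ident_left [OF a] by auto
qed

lemma dist_shift_cmp_zero:
  assumes d: "(X, Y, Z, f, g, h) \<in> Dist C"
  shows "Cmp C (sar f) h = Zero C Z (sob Y)"
proof -
  have t: "f \<in> Hom C X Y" "g \<in> Hom C Y Z" "h \<in> Hom C Z (sob X)" using dist_typed [OF d] by auto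
  show ?thesis
    using dist_cmp_zero [OF dist_rotate [OF dist_rotate [OF d]]] cmp_neg_left [OF t(3) shift.far_in [OF t(1)]]
      neg_eq_zero_iff [OF cmp_in [OF t(3) shift.far_in [OF t(1)]]] by simp
qed

text \<open>This is \<open>dist_lift\<close> for the triangle rotated twice. The sign of the rotated
  morphism does not affect whether a composite vanishes, so \<open>sar f\<close> can replace its
  negative.\<close>

lemma dist_shift_lift:
  assumes d: "(X, Y, Z, f, g, h) \<in> Dist C" and a: "a \<in> Hom C W (sob X)"
    and 0: "Cmp C (sar f) a = Zero C W (sob Y)"
  shows "\<exists>b \<in> Hom C W Z. Cmp C h b = a"
proof -
  have t: "f \<in> Hom C X Y" "g \<in> Hom C Y Z" "h \<in> Hom C Z (sob X)" using dist_typed [OF d] by auto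
  show ?thesis
    using dist_lift [OF dist_rotate [OF dist_rotate [OF d]] a] cmp_neg_left [OF a shift.far_in [OF t(1)]]
      neg_eq_zero_iff [OF cmp_in [OF a shift.far_in [OF t(1)]]] 0 by simp
qed

lemma dist_shift:
  assumes "(X, Y, Z, f, g, h) \<in> Dist C"
  shows "\<exists>f g h. (sob X, sob Y, sob Z, f, g, h) \<in> Dist C"
  using dist_rotate [OF dist_rotate [OF dist_rotate [OF assms]]] by blast

lemma shift_neg_surj:
  assumes "g \<in> Hom C (sob X) (sob Y)" "X \<in> Obj C" "Y \<in> Obj C"
  obtains f where "f \<in> Hom C X Y" "g = Neg C (sob X) (sob Y) (sar f)"
  using shift_surj_hom [OF neg_in [OF assms(1)] assms(2,3)] neg_neg [OF assms(1)] by metis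

text \<open>Three rotations shift all objects and negate the shifted morphisms. Writing each
  morphism as such a negative lets \<open>TR2\<close> be read backwards three times.\<close>

lemma dist_unshift:
  assumes d: "(sob X, sob Y, sob Z, f, g, h) \<in> Dist C"
    and ob: "X \<in> Obj C" "Y \<in> Obj C" "Z \<in> Obj C"
  shows "\<exists>f g h. (X, Y, Z, f, g, h) \<in> Dist C"
proof -
  have t: "f \<in> Hom C (sob X) (sob Y)" "g \<in> Hom C (sob Y) (sob Z)" "h \<in> Hom C (sob Z) (sob (sob X))"
    using dist_typed [OF d] by auto
  obtain f' where f: "f' \<in> Hom C X Y" "f = Neg C (sob X) (sob Y) (sar f')"
    using shift_neg_surj [OF t(1)] ob by blast
  obtain g' where g: "g' \<in> Hom C Y Z" "g = Neg C (sob Y) (sob Z) (sar g')"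
    using shift_neg_surj [OF t(2)] ob by blast
  obtain h' where h: "h' \<in> Hom C Z (sob X)" "h = Neg C (sob Z) (sob (sob X)) (sar h')"
    using shift_neg_surj [OF t(3)] ob shift.fob_in by blast
  have "(Z, sob X, sob Y, h', f, g) \<in> Dist C"
    using TR2 [OF h(1) t(1,2)] d h(2) by simp
  then have "(Y, Z, sob X, g', h', f) \<in> Dist C"
    using TR2 [OF g(1) h(1) t(1)] g(2) by simp
  then show ?thesis
    using TR2 [OF f(1) g(1) h(1)] f(2) by auto
qed

lemma retract_closed_shift_iff:
  assumes "S \<subseteq> Obj C"
  shows "retract_closed C (sob ` S) \<longleftrightarrow> retract_closed C S"
proof
  assume *: "retract_closed C (sob ` S)"
  show "retract_closed C S"
    unfolding retract_closed_def
  proof (intro ballI impI)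
    fix X Y assume "X \<in> S" "Y \<in> Obj C" "is_retract C Y X"
    then have "sob Y \<in> sob ` S"
      using * is_retract_shiftI shift.fob_in unfolding retract_closed_def by blast
    then show "Y \<in> S"
      using inj_on_image_mem_iff [OF shift_inj_obj _ assms] \<open>Y \<in> Obj C\<close> by blast
  qed
next
  assume *: "retract_closed C S"
  show "retract_closed C (sob ` S)"
    unfolding retract_closed_def
  proof (intro ballI impI)
    fix X' Y assume "X' \<in> sob ` S" and Y: "Y \<in> Obj C" and r: "is_retract C Y X'"
    then obtain X where X: "X \<in> S" "X' = sob X" by blast
    obtain Y' where "Y' \<in> Obj C" "Y = sob Y'" using shift_surj_obj Y by blast
    then show "Y \<in> sob ` S"
      using * X r is_retract_shift assms unfolding retract_closed_def by blast
  qed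
qed

text \<open>If \<open>g\<close> is zero, the identity of \<open>Y\<close> lifts along
  \<open>f\<close>, so \<open>f\<close> is a split epimorphism.\<close>

lemma retract_left_if_zero:
  assumes d: "(X, Y, Z, f, g, h) \<in> Dist C" and "g = Zero C Y Z"
  shows "is_retract C Y X"
proof -
  have t: "f \<in> Hom C X Y" "g \<in> Hom C Y Z" using dist_typed [OF d] by auto
  have Y: "Y \<in> Obj C" using hom_obj [OF t(1)] by blast
  have "Cmp C g (Ident C Y) = Zero C Y Z" using ident_right [OF t(2)] assms(2) by simp
  then show ?thesis
    using dist_lift [OF d ident_in [OF Y]] t(1) unfolding is_retract_def by blast
qed

lemma retract_right_if_zero:
  assumes d: "(X, Y, Z, f, g, h) \<in> Dist C" and "f = Zero C X Y"
  shows "is_retract C Y Z"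
proof -
  have t: "f \<in> Hom C X Y" "g \<in> Hom C Y Z" using dist_typed [OF d] by auto
  have Y: "Y \<in> Obj C" using hom_obj [OF t(1)] by blast
  have "Cmp C (Ident C Y) f = Zero C X Y" using ident_left [OF t(1)] assms(2) by simp
  then show ?thesis
    using dist_extend [OF d ident_in [OF Y]] t(2) unfolding is_retract_def by blast
qed

section \<open>Integer shifts of objects\<close>

lemma shift_obj_0 [simp]: "shift_obj C 0 X = X"
  by (simp add: shift_obj_def)

lemma inv_shift_in: "X \<in> Obj C \<Longrightarrow> (inv_into (Obj C) sob ^^ n) X \<in> Obj C"
proof (induction n)
  case (Suc n)
  have "sob ` Obj C = Obj C" using shift_bij_obj unfolding bij_betw_def by blast
  then show ?case using Suc inv_into_into [of _ sob "Obj C"] by simp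
qed simp

lemma shift_obj_in: "X \<in> Obj C \<Longrightarrow> shift_obj C i X \<in> Obj C"
proof -
  assume X: "X \<in> Obj C"
  then have "(sob ^^ n) X \<in> Obj C" for n
    by (induction n) (auto intro: shift.fob_in)
  then show ?thesis using inv_shift_in [OF X] by (simp add: shift_obj_def)
qed

lemma shift_obj_Suc:
  assumes X: "X \<in> Obj C"
  shows "shift_obj C (i + 1) X = sob (shift_obj C i X)"
proof (cases "i \<ge> 0")
  case True
  then show ?thesis by (simp add: shift_obj_def nat_add_distrib)
next
  case False
  \<comment> \<open>For negative \<open>i\<close>, the object X[i] arises from \<open>k + 1\<close>
    inverse shifts, and a further shift cancels the outermost. At \<open>i = -1\<close> the result
    is given by the other branch of \<open>shift_obj\<close>, with \<open>k = 0\<close>.\<close>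
  define k where "k = nat (- (i + 1))"
  have k: "nat (- i) = Suc k" "nat (-i - 1) = k" using False by (auto simp: k_def)
  have "sob ` Obj C = Obj C" using shift_bij_obj unfolding bij_betw_def by blast
  then have "sob (inv_into (Obj C) sob ((inv_into (Obj C) sob ^^ k) X)) = (inv_into (Obj C) sob ^^ k) X"
    using inv_shift_in [OF X, of k] by (simp add: f_inv_into_f)
  moreover have "shift_obj C (i + 1) X = (inv_into (Obj C) sob ^^ k) X"
    using False k by (cases "i = -1") (auto simp: shift_obj_def)
  ultimately show ?thesis using False k by (simp add: shift_obj_def)
qed

end

section \<open>Weight structures\<close>

context weight_structure
begin

lemma wle_Suc: "wle C w (i + 1) = sob ` wle C w i"
  unfolding wle_def image_image using wle0_obj by (intro image_cong) (auto simp: shift_obj_Suc)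

lemma wge_Suc: "wge C w (i + 1) = sob ` wge C w i"
  unfolding wge_def image_image using wge0_obj by (intro image_cong) (auto simp: shift_obj_Suc)

lemma wle_0 [simp]: "wle C w 0 = wle0 w" and wge_0 [simp]: "wge C w 0 = wge0 w"
  by (simp_all add: wle_def wge_def)

lemma wle_obj: "wle C w i \<subseteq> Obj C" and wge_obj: "wge C w i \<subseteq> Obj C"
  unfolding wle_def wge_def using wle0_obj wge0_obj shift_obj_in by auto

lemma weq_obj: "weq C w i \<subseteq> Obj C"
  unfolding weq_def using wle_obj by blast

lemma shift_wle_iff: "X \<in> Obj C \<Longrightarrow> sob X \<in> wle C w (i + 1) \<longleftrightarrow> X \<in> wle C w i"
  unfolding wle_Suc using inj_on_image_mem_iff [OF shift_inj_obj _ wle_obj] by blast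

lemma shift_wge_iff: "X \<in> Obj C \<Longrightarrow> sob X \<in> wge C w (i + 1) \<longleftrightarrow> X \<in> wge C w i"
  unfolding wge_Suc using inj_on_image_mem_iff [OF shift_inj_obj _ wge_obj] by blast

lemma weq_Suc: "weq C w (i + 1) = sob ` weq C w i"
  unfolding weq_def wle_Suc wge_Suc
  using inj_on_image_Int [OF shift_inj_obj wge_obj wle_obj] by simp

lemma wle_retract_closed: "retract_closed C (wle C w i)"
  by (rule int_bi_induct [where k = 0])
    (simp_all add: wle0_retract_closed wle_Suc retract_closed_shift_iff wle_obj)

lemma wge_retract_closed: "retract_closed C (wge C w i)"
  by (rule int_bi_induct [where k = 0])
    (simp_all add: wge0_retract_closed wge_Suc retract_closed_shift_iff wge_obj)

lemma wle_retract: "X \<in> wle C w i \<Longrightarrow> is_retract C Y X \<Longrightarrow> Y \<in> wle C w i"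
  using wle_retract_closed hom_obj unfolding retract_closed_def is_retract_def by blast

lemma wge_retract: "X \<in> wge C w i \<Longrightarrow> is_retract C Y X \<Longrightarrow> Y \<in> wge C w i"
  using wge_retract_closed hom_obj unfolding retract_closed_def is_retract_def by blast

lemma wle_subset_Suc: "wle C w i \<subseteq> wle C w (i + 1)" (is "?P i")
proof (rule int_bi_induct [where k = 0 and P = ?P])
  show "wle C w 0 \<subseteq> wle C w (0 + 1)" using wle0_shift by simp
  show "wle C w i \<subseteq> wle C w (i + 1) \<longleftrightarrow> wle C w (i + 1) \<subseteq> wle C w (i + 1 + 1)" for i
    using shift_image_subset_iff [OF wle_obj [of i] wle_obj [of "i + 1"]]
    unfolding wle_Suc [symmetric] by (rule sym)
qed

lemma wge_Suc_subset: "wge C w (i + 1) \<subseteq> wge C w i" (is "?P i")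
proof (rule int_bi_induct [where k = 0 and P = ?P])
  show "wge C w (0 + 1) \<subseteq> wge C w 0" using wge0_shift by simp
  show "wge C w (i + 1) \<subseteq> wge C w i \<longleftrightarrow> wge C w (i + 1 + 1) \<subseteq> wge C w (i + 1)" for i
    using shift_image_subset_iff [OF wge_obj [of "i + 1"] wge_obj [of i]]
    unfolding wge_Suc [symmetric] by (rule sym)
qed

lemma wle_mono: "i \<le> j \<Longrightarrow> wle C w i \<subseteq> wle C w j"
  by (induction j rule: int_ge_induct) (use wle_subset_Suc in blast)+

lemma wge_antimono: "i \<le> j \<Longrightarrow> wge C w j \<subseteq> wge C w i"
  by (induction j rule: int_ge_induct) (use wge_Suc_subset in blast)+

section \<open>Orthogonality and weight decompositions at every level\<close>

lemma hom_trivial_shift_iff: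
  assumes "X \<in> Obj C" "Y \<in> Obj C"
  shows "Hom C (sob X) (sob Y) = {Zero C (sob X) (sob Y)} \<longleftrightarrow> Hom C X Y = {Zero C X Y}"
proof -
  have "Hom C (sob X) (sob Y) = sar ` Hom C X Y"
    "{Zero C (sob X) (sob Y)} = sar ` {Zero C X Y}" "inj_on sar (Hom C X Y)"
    using shift_bij_hom [OF assms] shift.far_zero [OF assms] unfolding bij_betw_def by auto
  then show ?thesis
    using inj_on_image_eq_iff zero_in [OF assms] by (metis empty_subsetI insert_subset order_refl)
qed

lemma wle_wge_hom_trivial:
  assumes "X \<in> wle C w i" "Y \<in> wge C w (i + 1)"
  shows "Hom C X Y = {Zero C X Y}"
proof -
  \<comment> \<open>The objects are quantified inside the induction, because passing to the next
    level replaces them by their shifts.\<close>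
  have "\<forall>X \<in> wle C w i. \<forall>Y \<in> wge C w (i + 1). Hom C X Y = {Zero C X Y}"
    (is "?P i")
  proof (rule int_bi_induct [where k = 0 and P = ?P])
    show "\<forall>X \<in> wle C w 0. \<forall>Y \<in> wge C w (0 + 1). Hom C X Y = {Zero C X Y}"
      using orthogonality by simp
    show "(\<forall>X \<in> wle C w i. \<forall>Y \<in> wge C w (i + 1). Hom C X Y = {Zero C X Y}) \<longleftrightarrow>
      (\<forall>X \<in> wle C w (i + 1). \<forall>Y \<in> wge C w (i + 1 + 1). Hom C X Y = {Zero C X Y})" for i
      unfolding wle_Suc [of i] wge_Suc [of "i + 1"]
      using hom_trivial_shift_iff wle_obj [of i] wge_obj [of "i + 1"] by (simp add: subset_iff)
  qed
  then show ?thesis using assms by blast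
qed

text \<open>Shifting a triangle that decomposes M at level \<open>i\<close> decomposes M[1] at level
  \<open>i + 1\<close>, and unshifting reverses this. As every object is a shift, the two levels are
  equivalent.\<close>

lemma weight_decomposition_at:
  assumes "M \<in> Obj C"
  shows "\<exists>L \<in> wle C w i. \<exists>R \<in> wge C w (i + 1). \<exists>f g h. (L, M, R, f, g, h) \<in> Dist C"
proof -
  have "\<forall>M \<in> Obj C. \<exists>L \<in> wle C w i. \<exists>R \<in> wge C w (i + 1). \<exists>f g h. (L, M, R, f, g, h) \<in> Dist C"
    (is "?P i")
  proof (rule int_bi_induct [where k = 0 and P = ?P])
    show "?P 0" using weight_decomposition by simp
    fix i
    show "?P i \<longleftrightarrow> ?P (i + 1)"
    proof
      assume P: "?P i"
      show "?P (i + 1)"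
      proof
        fix M' assume "M' \<in> Obj C"
        then obtain M where M: "M \<in> Obj C" "M' = sob M" using shift_surj_obj by blast
        obtain L R f g h where LR: "L \<in> wle C w i" "R \<in> wge C w (i + 1)"
          and d: "(L, M, R, f, g, h) \<in> Dist C"
          using bspec [OF P M(1)] by blast
        have "sob L \<in> wle C w (i + 1)" "sob R \<in> wge C w (i + 1 + 1)"
          unfolding wle_Suc [of i] wge_Suc [of "i + 1"] using LR by auto
        then show "\<exists>L \<in> wle C w (i + 1). \<exists>R \<in> wge C w (i + 1 + 1). \<exists>f g h. (L, M', R, f, g, h) \<in> Dist C"
          using dist_shift [OF d] M(2) by blast
      qed
    next
      assume P: "?P (i + 1)"
      show "?P i"
      proof
        fix M assume M: "M \<in> Obj C"
        obtain L' R' f g h where "L' \<in> sob ` wle C w i" "R' \<in> sob ` wge C w (i + 1)"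
          "(L', sob M, R', f, g, h) \<in> Dist C"
          using bspec [OF P shift.fob_in [OF M]] unfolding wle_Suc [of i] wge_Suc [of "i + 1"] by blast
        then obtain L R where LR: "L \<in> wle C w i" "R \<in> wge C w (i + 1)"
          and d: "(sob L, sob M, sob R, f, g, h) \<in> Dist C"
          by blast
        have "L \<in> Obj C" "R \<in> Obj C" using LR wle_obj wge_obj by auto
        then show "\<exists>L \<in> wle C w i. \<exists>R \<in> wge C w (i + 1). \<exists>f g h. (L, M, R, f, g, h) \<in> Dist C"
          using dist_unshift [OF d _ M] LR by blast
      qed
    qed
  qed
  then show ?thesis by (rule bspec) (rule assms)
qed

text \<open>The converse of orthogonality: the hypothesis annihilates M -> R in a weight
  decomposition, which makes M a retract of L.\<close>

lemma wleI_orthogonal: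
  assumes M: "M \<in> Obj C"
    and 0: "\<And>Y f. Y \<in> wge C w (i + 1) \<Longrightarrow> f \<in> Hom C M Y \<Longrightarrow> f = Zero C M Y"
  shows "M \<in> wle C w i"
proof -
  obtain L R f g h where LR: "L \<in> wle C w i" "R \<in> wge C w (i + 1)"
    and d: "(L, M, R, f, g, h) \<in> Dist C"
    using weight_decomposition_at [OF M] by blast
  have "g = Zero C M R" using 0 [OF LR(2)] dist_typed [OF d] by blast
  then show ?thesis using wle_retract [OF LR(1) retract_left_if_zero [OF d]] by blast
qed

lemma wgeI_orthogonal:
  assumes M: "M \<in> Obj C"
    and 0: "\<And>X f. X \<in> wle C w i \<Longrightarrow> f \<in> Hom C X M \<Longrightarrow> f = Zero C X M"
  shows "M \<in> wge C w (i + 1)"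
proof -
  obtain L R f g h where LR: "L \<in> wle C w i" "R \<in> wge C w (i + 1)"
    and d: "(L, M, R, f, g, h) \<in> Dist C"
    using weight_decomposition_at [OF M] by blast
  have "f = Zero C L M" using 0 [OF LR(1)] dist_typed [OF d] by blast
  then show ?thesis using wge_retract [OF LR(2) retract_right_if_zero [OF d]] by blast
qed

lemma zero_object_wle:
  assumes "is_zero_object C Z"
  shows "Z \<in> wle C w i"
  using assms unfolding is_zero_object_def by (intro wleI_orthogonal) (use hom_obj zero_in in blast)+

lemma zero_object_wge:
  assumes "is_zero_object C Z"
  shows "Z \<in> wge C w i"
  using wgeI_orthogonal [of Z "i - 1"] assms hom_obj zero_in unfolding is_zero_object_def by force

text \<open>A morphism from R to an object of weights at least \<open>i + 1\<close> vanishes on M,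
  hence factors through L[1], whose weights are at most \<open>i\<close>; so it is zero. Applied to
  a weight decomposition, this shows that R has weight exactly \<open>i\<close>.\<close>

lemma wle_cone:
  assumes d: "(L, M, R, f, g, h) \<in> Dist C" and M: "M \<in> wle C w i" and L: "L \<in> wle C w (i - 1)"
  shows "R \<in> wle C w i"
proof (rule wleI_orthogonal)
  have t: "f \<in> Hom C L M" "g \<in> Hom C M R" "h \<in> Hom C R (sob L)" using dist_typed [OF d] by auto
  show "R \<in> Obj C" using hom_obj [OF t(2)] by blast
  have sL: "sob L \<in> wle C w i" using L wle_Suc [of "i - 1"] by simp
  fix Y a assume Y: "Y \<in> wge C w (i + 1)" and a: "a \<in> Hom C R Y"
  have "Cmp C a g = Zero C M Y"
    using wle_wge_hom_trivial [OF M Y] cmp_in [OF t(2) a] by blast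
  then obtain b where b: "b \<in> Hom C (sob L) Y" "Cmp C b h = a"
    using dist_extend [OF dist_rotate [OF d] a] by blast
  then have "b = Zero C (sob L) Y" using wle_wge_hom_trivial [OF sL Y] by blast
  then show "a = Zero C R Y" using b cmp_zero_left [OF t(3)] wge_obj Y by blast
qed

text \<open>Dual to \<open>wle_cone\<close>. Orthogonality is tested on L[1], which sits between R
  and M[1], both of weights at least \<open>i + 1\<close>; the bound is then shifted back to
  L.\<close>

lemma wge_fibre:
  assumes d: "(L, M, R, f, g, h) \<in> Dist C" and M: "M \<in> wge C w i" and R: "R \<in> wge C w (i + 1)"
  shows "L \<in> wge C w i"
proof -
  have t: "f \<in> Hom C L M" "g \<in> Hom C M R" "h \<in> Hom C R (sob L)" using dist_typed [OF d] by auto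
  have L: "L \<in> Obj C" using hom_obj [OF t(1)] by blast
  have sM: "sob M \<in> wge C w (i + 1)" using M wge_Suc by blast
  have "sob L \<in> wge C w (i + 1)"
  proof (rule wgeI_orthogonal)
    show "sob L \<in> Obj C" using L shift.fob_in by blast
    fix X a assume X: "X \<in> wle C w i" and a: "a \<in> Hom C X (sob L)"
    have "Cmp C (sar f) a = Zero C X (sob M)"
      using wle_wge_hom_trivial [OF X sM] cmp_in [OF a shift.far_in [OF t(1)]] by blast
    then obtain b where b: "b \<in> Hom C X R" "Cmp C h b = a"
      using dist_shift_lift [OF d a] by blast
    then have "b = Zero C X R" using wle_wge_hom_trivial [OF X R] by blast
    then show "a = Zero C X (sob L)" using b cmp_zero_right [OF _ t(3)] wle_obj X by blast
  qed
  then show ?thesis using shift_wge_iff [OF L] by blast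
qed

lemma bounded_degenerate_zero:
  assumes "M \<in> wle C w i" "M \<in> wge C w (i + 1)"
  shows "is_zero_object C M"
proof -
  have "M \<in> Obj C" using assms wle_obj by blast
  then show ?thesis
    using wle_wge_hom_trivial [OF assms] ident_in is_zero_object_iff by blast
qed

end

section \<open>Weight-exact functors\<close>

context exact_functor
begin

text \<open>Conjugation by \<eta> identifies morphisms F(X[1]) -> F(Y[1]) with morphisms F(X)[1] ->
  F(Y)[1], which are the shifts of morphisms F(X) -> F(Y). Naturality makes this compatible with the
  action of F.\<close>

lemma full_shift_iff:
  assumes ob: "X \<in> Obj C" "Y \<in> Obj C"
  shows "(\<forall>r \<in> Hom D (fob F (fob (Shift C) X)) (fob F (fob (Shift C) Y)).
           \<exists>s \<in> Hom C (fob (Shift C) X) (fob (Shift C) Y). far F s = r) \<longleftrightarrow>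
         (\<forall>r \<in> Hom D (fob F X) (fob F Y). \<exists>s \<in> Hom C X Y. far F s = r)"
    (is "?S \<longleftrightarrow> ?T")
proof -
  have iX: "is_iso D (fob F (source.sob X)) (target.sob (fob F X)) (\<eta> X)"
    and iY: "is_iso D (fob F (source.sob Y)) (target.sob (fob F Y)) (\<eta> Y)"
    using \<eta>_iso ob by auto
  \<comment> \<open>\<open>X'\<close> and \<open>Y'\<close> are morphisms, taken from the inverses
    of \<open>\<eta> X\<close> and \<open>\<eta> Y\<close>.\<close>
  obtain X' where X': "X' \<in> Hom D (target.sob (fob F X)) (fob F (source.sob X))"
      "Cmp D X' (\<eta> X) = Ident D (fob F (source.sob X))"
    using iX unfolding is_iso_def by blast
  obtain Y' where Y': "Y' \<in> Hom D (target.sob (fob F Y)) (fob F (source.sob Y))"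
      "Cmp D (\<eta> Y) Y' = Ident D (target.sob (fob F Y))"
    using iY unfolding is_iso_def by blast
  have X: "\<eta> X \<in> Hom D (fob F (source.sob X)) (target.sob (fob F X))"
    and Y: "\<eta> Y \<in> Hom D (fob F (source.sob Y)) (target.sob (fob F Y))"
    using iX iY unfolding is_iso_def by auto
  have Fob: "fob F X \<in> Obj D" "fob F Y \<in> Obj D" using ob fob_in by auto
  show ?thesis
  proof
    assume S: ?S
    show ?T
    proof
      fix r assume r: "r \<in> Hom D (fob F X) (fob F Y)"
      have sr: "target.sar r \<in> Hom D (target.sob (fob F X)) (target.sob (fob F Y))" using target.shift.far_in r by blast
      let ?r = "Cmp D Y' (Cmp D (target.sar r) (\<eta> X))"
      have "?r \<in> Hom D (fob F (source.sob X)) (fob F (source.sob Y))"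
        using target.cmp_in sr X Y'(1) by blast
      then obtain s' where s': "s' \<in> Hom C (source.sob X) (source.sob Y)" "far F s' = ?r"
        using S by blast
      obtain s where s: "s \<in> Hom C X Y" "s' = source.sar s"
        using source.shift_surj_hom s'(1) ob by blast
      have "Cmp D (target.sar (far F s)) (\<eta> X) = Cmp D (\<eta> Y) ?r"
        using \<eta>_natural [OF s(1)] s s' by simp
      also have "\<dots> = Cmp D (target.sar r) (\<eta> X)"
        using target.cmp_assoc [OF target.cmp_in [OF X sr] Y'(1) Y] Y'(2)
          target.ident_left [OF target.cmp_in [OF X sr]] by simp
      finally have "target.sar (far F s) = target.sar r"
        using target.is_iso_cancel_right [OF iX target.shift.far_in [OF far_in [OF s(1)]] sr] by simp
      then show "\<exists>s \<in> Hom C X Y. far F s = r"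
        using target.shift_faithful [OF far_in [OF s(1)] r] s by blast
    qed
  next
    assume T: ?T
    show ?S
    proof
      fix r assume r: "r \<in> Hom D (fob F (source.sob X)) (fob F (source.sob Y))"
      let ?r = "Cmp D (Cmp D (\<eta> Y) r) X'"
      have "?r \<in> Hom D (target.sob (fob F X)) (target.sob (fob F Y))"
        using target.cmp_in r Y X'(1) by blast
      then obtain r0 where r0: "r0 \<in> Hom D (fob F X) (fob F Y)" "?r = target.sar r0"
        using target.shift_surj_hom Fob by blast
      obtain s where s: "s \<in> Hom C X Y" "far F s = r0" using T r0(1) by blast
      have "Cmp D (\<eta> Y) (far F (source.sar s)) = Cmp D ?r (\<eta> X)"
        using \<eta>_natural [OF s(1)] s r0 by simp
      also have "\<dots> = Cmp D (\<eta> Y) r"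
        using target.cmp_assoc [OF X X'(1) target.cmp_in [OF r Y]] X'(2)
          target.ident_right [OF target.cmp_in [OF r Y]] by simp
      finally have "far F (source.sar s) = r"
        using target.is_iso_cancel_left [OF iY far_in [OF source.shift.far_in [OF s(1)]] r] by simp
      then show "\<exists>s \<in> Hom C (source.sob X) (source.sob Y). far F s = r"
        using source.shift.far_in [OF s(1)] by blast
    qed
  qed
qed

lemma far_shift_eq_ident_iff:
  assumes u: "u \<in> Hom C X X"
  shows "far F (far (Shift C) u) = Ident D (fob F (fob (Shift C) X)) \<longleftrightarrow> far F u = Ident D (fob F X)"
proof -
  have X: "X \<in> Obj C" using source.hom_obj [OF u] by blast
  have i: "is_iso D (fob F (source.sob X)) (target.sob (fob F X)) (\<eta> X)" using \<eta>_iso X by blast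
  then have e: "\<eta> X \<in> Hom D (fob F (source.sob X)) (target.sob (fob F X))" unfolding is_iso_def by blast
  note FsX = fob_in [OF source.shift.fob_in [OF X]] and sFX = target.shift.fob_in [OF fob_in [OF X]]
  have "far F (source.sar u) = Ident D (fob F (source.sob X)) \<longleftrightarrow>
      Cmp D (\<eta> X) (far F (source.sar u)) = \<eta> X"
    using target.is_iso_cancel_left [OF i far_in [OF source.shift.far_in [OF u]] target.ident_in [OF FsX]]
      target.ident_right [OF e] by auto
  also have "\<dots> \<longleftrightarrow> target.sar (far F u) = Ident D (target.sob (fob F X))"
    unfolding \<eta>_natural [OF u]
    using target.is_iso_cancel_right [OF i target.shift.far_in [OF far_in [OF u]] target.ident_in [OF sFX]]
      target.ident_left [OF e] by auto
  also have "\<dots> \<longleftrightarrow> far F u = Ident D (fob F X)"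
    using target.shift_faithful [OF far_in [OF u] target.ident_in [OF fob_in [OF X]]]
      target.shift.far_ident [OF fob_in [OF X]] by auto
  finally show ?thesis .
qed

text \<open>Conservativity enters only through endomorphisms that F sends to an identity. This
  special case passes along the shift by \<open>far_shift_eq_ident_iff\<close>, with no general
  isomorphisms of the target to transport.\<close>

lemma reflect_ident_shift_iff:
  assumes X: "X \<in> Obj C"
  shows "(\<forall>u \<in> Hom C (fob (Shift C) X) (fob (Shift C) X).
            far F u = Ident D (fob F (fob (Shift C) X)) \<longrightarrow> is_iso C (fob (Shift C) X) (fob (Shift C) X) u) \<longleftrightarrow>
         (\<forall>u \<in> Hom C X X. far F u = Ident D (fob F X) \<longrightarrow> is_iso C X X u)"
proof -
  have "Hom C (source.sob X) (source.sob X) = source.sar ` Hom C X X"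
    using source.shift_bij_hom [OF X X] unfolding bij_betw_def by blast
  then show ?thesis
    using far_shift_eq_ident_iff source.is_iso_shift_iff by simp
qed

end

context weight_exact_functor
begin

lemma image_wle:
  assumes "X \<in> wle C w i"
  shows "fob F X \<in> wle D w' i"
proof -
  \<comment> \<open>F commutes with the shift only up to \<eta>; closure under retracts carries
    membership across this isomorphism in both directions.\<close>
  have iff: "fob F (source.sob X) \<in> wle D w' (j + 1) \<longleftrightarrow> fob F X \<in> wle D w' j" if "X \<in> wle C w j" for j X
  proof -
    have X: "X \<in> Obj C" using that source.wle_obj by blast
    show ?thesis
      using target.wle_retract target.is_iso_retract [OF \<eta>_iso [OF X]]
        target.shift_wle_iff [OF fob_in [OF X]] by blast
  qed
  have "\<forall>X \<in> wle C w i. fob F X \<in> wle D w' i" (is "?P i")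
  proof (rule int_bi_induct [where k = 0 and P = ?P])
    show "?P 0" using wle0_image by auto
    show "?P j \<longleftrightarrow> ?P (j + 1)" for j
      unfolding source.wle_Suc using iff by simp
  qed
  then show ?thesis using assms by blast
qed

lemma image_wge:
  assumes "X \<in> wge C w i"
  shows "fob F X \<in> wge D w' i"
proof -
  have iff: "fob F (source.sob X) \<in> wge D w' (j + 1) \<longleftrightarrow> fob F X \<in> wge D w' j" if "X \<in> wge C w j" for j X
  proof -
    have X: "X \<in> Obj C" using that source.wge_obj by blast
    show ?thesis
      using target.wge_retract target.is_iso_retract [OF \<eta>_iso [OF X]]
        target.shift_wge_iff [OF fob_in [OF X]] by blast
  qed
  have "\<forall>X \<in> wge C w i. fob F X \<in> wge D w' i" (is "?P i")
  proof (rule int_bi_induct [where k = 0 and P = ?P])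
    show "?P 0" using wge0_image by auto
    show "?P j \<longleftrightarrow> ?P (j + 1)" for j
      unfolding source.wge_Suc using iff by simp
  qed
  then show ?thesis using assms by blast
qed

lemma image_weq: "X \<in> weq C w i \<Longrightarrow> fob F X \<in> weq D w' i"
  unfolding weq_def using image_wle image_wge by blast

end

section \<open>Functors that are full and conservative on the hearts\<close>

locale heart_full_conservative = weight_exact_functor +
  assumes heart_full: "full_functor (heart C w) (heart D w') F"
    and heart_conservative: "conservative_functor (heart C w) (heart D w') F"
begin

lemma full_at:
  assumes "X \<in> weq C w i" "Y \<in> weq C w i" "r \<in> Hom D (fob F X) (fob F Y)"
  obtains s where "s \<in> Hom C X Y" "far F s = r"
proof -
  have "\<forall>X \<in> weq C w i. \<forall>Y \<in> weq C w i.
      \<forall>r \<in> Hom D (fob F X) (fob F Y). \<exists>s \<in> Hom C X Y. far F s = r" (is "?P i")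
  proof (rule int_bi_induct [where k = 0 and P = ?P])
    \<comment> \<open>Morphism sets of the target heart are empty unless both objects lie in it,
      hence the appeal to \<open>image_weq\<close>.\<close>
    show "?P 0"
      using heart_full image_weq [of _ 0]
      unfolding full_functor_def heart_def full_subcategory_def by simp
    show "?P j \<longleftrightarrow> ?P (j + 1)" for j
      unfolding source.weq_Suc [of j] using full_shift_iff source.weq_obj [of j] by (simp add: subset_iff)
  qed
  then show ?thesis using assms that by blast
qed

lemma reflect_ident_at:
  assumes "X \<in> weq C w i" "u \<in> Hom C X X" "far F u = Ident D (fob F X)"
  shows "is_iso C X X u"
proof -
  have "\<forall>X \<in> weq C w i. \<forall>u \<in> Hom C X X. far F u = Ident D (fob F X) \<longrightarrow> is_iso C X X u" (is "?P i")
  proof (rule int_bi_induct [where k = 0 and P = ?P])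
    have "is_iso C X X u"
      if X: "X \<in> weq C w 0" and u: "u \<in> Hom C X X" "far F u = Ident D (fob F X)" for X u
    proof -
      have "is_iso D (fob F X) (fob F X) (far F u)"
        using target.is_iso_ident fob_in X source.weq_obj u(2) by auto
      then have "is_iso (heart D w') (fob F X) (fob F X) (far F u)"
        using image_weq [OF X] unfolding is_iso_def heart_def full_subcategory_def by simp
      then have "is_iso (heart C w) X X u"
        using heart_conservative X u(1)
        unfolding conservative_functor_def heart_def full_subcategory_def by simp
      then show ?thesis
        using X unfolding is_iso_def heart_def full_subcategory_def by simp
    qed
    then show "?P 0" by blast
    show "?P j \<longleftrightarrow> ?P (j + 1)" for j
      unfolding source.weq_Suc [of j] using reflect_ident_shift_iff source.weq_obj [of j]
      by (simp add: subset_iff)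
  qed
  then show ?thesis using assms by blast
qed

text \<open>Fullness lifts \<open>r\<close> to some \<open>t\<close>. As F sends \<open>t\<close>
  after \<open>u\<close> to an identity, that composite has an inverse \<open>v\<close>, and
  \<open>v\<close> after \<open>t\<close> is the retraction.\<close>

lemma split_mono_at:
  assumes X: "X \<in> weq C w i" and Y: "Y \<in> weq C w i" and u: "u \<in> Hom C X Y"
    and r: "r \<in> Hom D (fob F Y) (fob F X)" and 1: "Cmp D r (far F u) = Ident D (fob F X)"
  obtains s where "s \<in> Hom C Y X" "Cmp C s u = Ident C X"
proof -
  obtain t where t: "t \<in> Hom C Y X" "far F t = r" using full_at [OF Y X r] by blast
  have "is_iso C X X (Cmp C t u)"
    using reflect_ident_at [OF X source.cmp_in [OF u t(1)]] far_cmp [OF u t(1)] t(2) 1 by simp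
  then obtain v where "v \<in> Hom C X X" "Cmp C v (Cmp C t u) = Ident C X"
    unfolding is_iso_def by blast
  then show ?thesis
    using that source.cmp_in [OF t(1)] source.cmp_assoc [OF u t(1)] by metis
qed

lemma split_epi_at:
  assumes X: "X \<in> weq C w i" and Y: "Y \<in> weq C w i" and u: "u \<in> Hom C Y X"
    and r: "r \<in> Hom D (fob F X) (fob F Y)" and 1: "Cmp D (far F u) r = Ident D (fob F X)"
  obtains s where "s \<in> Hom C X Y" "Cmp C u s = Ident C X"
proof -
  obtain t where t: "t \<in> Hom C X Y" "far F t = r" using full_at [OF X Y r] by blast
  have "is_iso C X X (Cmp C u t)"
    using reflect_ident_at [OF X source.cmp_in [OF t(1) u]] far_cmp [OF t(1) u] t(2) 1 by simp
  then obtain v where "v \<in> Hom C X X" "Cmp C (Cmp C u t) v = Ident C X"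
    unfolding is_iso_def by blast
  then show ?thesis
    using that source.cmp_in [OF _ t(1)] source.cmp_assoc [OF _ t(1) u] by metis
qed

text \<open>The hypothesis \<open>kill\<close> concerns morphisms rather than F(M) itself, so that
  the lemma serves both reflection of weight bounds and the vanishing criterion for
  degeneracy.\<close>

lemma wle_descend:
  assumes M: "M \<in> wle C w i"
    and kill: "\<And>N g. N \<in> weq C w i \<Longrightarrow> g \<in> Hom C M N \<Longrightarrow> far F g = Zero D (fob F M) (fob F N)"
  shows "M \<in> wle C w (i - 1)"
proof -
  have Mo: "M \<in> Obj C" using M source.wle_obj by blast
  obtain L R f g h where L: "L \<in> wle C w (i - 1)" and R: "R \<in> wge C w (i - 1 + 1)"
    and d: "(L, M, R, f, g, h) \<in> Dist C"
    using source.weight_decomposition_at [OF Mo] by blast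
  have t: "g \<in> Hom C M R" "h \<in> Hom C R (source.sob L)"
    using source.dist_typed [OF d] by auto
  have Req: "R \<in> weq C w i" using R source.wle_cone [OF d M L] unfolding weq_def by simp
  have sL: "source.sob L \<in> wle C w i" using L source.wle_Suc [of "i - 1"] by simp
  have ob: "L \<in> Obj C" "R \<in> Obj C" "source.sob L \<in> Obj C"
    using source.wle_obj source.weq_obj L Req sL by auto
  note Fd = dist_image [OF d]
  have Fh: "far F h \<in> Hom D (fob F R) (fob F (source.sob L))" using far_in t by blast
  have eL: "\<eta> L \<in> Hom D (fob F (source.sob L)) (target.sob (fob F L))"
    using \<eta>_iso [OF ob(1)] unfolding is_iso_def by blast
  \<comment> \<open>Since F(g) is zero, the identity of F(R) extends along the next morphism of the
    image triangle. That morphism ends in F(L)[1], so the retraction \<open>b\<close> is composed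
    with \<open>\<eta> L\<close> below.\<close>
  have "Cmp D (Ident D (fob F R)) (far F g) = Zero D (fob F M) (fob F R)"
    using kill [OF Req t(1)] target.ident_left [OF far_in [OF t(1)]] by simp
  then obtain b where b: "b \<in> Hom D (target.sob (fob F L)) (fob F R)"
      "Cmp D b (Cmp D (\<eta> L) (far F h)) = Ident D (fob F R)"
    using target.dist_extend [OF target.dist_rotate [OF Fd] target.ident_in [OF fob_in [OF ob(2)]]]
    by blast
  define r where "r = Cmp D b (\<eta> L)"
  have r: "r \<in> Hom D (fob F (source.sob L)) (fob F R)"
    "Cmp D r (far F h) = Ident D (fob F R)"
    unfolding r_def using target.cmp_in [OF eL b(1)] target.cmp_assoc [OF Fh eL b(1)] b(2) by auto
  \<comment> \<open>L[1] has weights at most \<open>i\<close> but need not have weight exactly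
    \<open>i\<close>, so the lifting lemma does not apply to \<open>h\<close>. The object
    \<open>R2\<close> of weight \<open>i\<close> takes the place of L[1].\<close>
  obtain L2 R2 f2 g2 h2 where L2: "L2 \<in> wle C w (i - 1)" and R2: "R2 \<in> wge C w (i - 1 + 1)"
    and d2: "(L2, source.sob L, R2, f2, g2, h2) \<in> Dist C"
    using source.weight_decomposition_at [OF ob(3)] by blast
  have t2: "f2 \<in> Hom C L2 (source.sob L)" "g2 \<in> Hom C (source.sob L) R2"
    using source.dist_typed [OF d2] by auto
  have R2eq: "R2 \<in> weq C w i" using R2 source.wle_cone [OF d2 sL L2] unfolding weq_def by simp
  \<comment> \<open>F(L2) has weights at most \<open>i - 1\<close> and F(R) at least
    \<open>i\<close>, so \<open>r\<close> factors through F(R2).\<close>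
  have "Cmp D r (far F f2) = Zero D (fob F L2) (fob F R)"
    using target.wle_wge_hom_trivial [OF image_wle [OF L2] image_wge [OF R]]
      target.cmp_in [OF far_in [OF t2(1)] r(1)] by blast
  then obtain c where c: "c \<in> Hom D (fob F R2) (fob F R)" "Cmp D c (far F g2) = r"
    using target.dist_extend [OF dist_image [OF d2] r(1)] by blast
  have "Cmp D c (far F (Cmp C g2 h)) = Ident D (fob F R)"
    using far_cmp [OF t(2) t2(2)] target.cmp_assoc [OF Fh far_in [OF t2(2)] c(1)] c(2) r(2) by simp
  then obtain s where s: "s \<in> Hom C R2 R" "Cmp C s (Cmp C g2 h) = Ident C R"
    using split_mono_at [OF Req R2eq source.cmp_in [OF t(2) t2(2)] c(1)] by blast
  have hg: "Cmp C h g = Zero C M (source.sob L)"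
    using source.dist_cmp_zero [OF source.dist_rotate [OF d]] .
  \<comment> \<open>The morphism \<open>h\<close> has a retraction, while \<open>h\<close> after
    \<open>g\<close> is zero; hence \<open>g\<close> is zero.\<close>
  have "g = Cmp C (Cmp C s (Cmp C g2 h)) g" using s source.ident_left [OF t(1)] by simp
  also have "\<dots> = Cmp C (Cmp C s g2) (Cmp C h g)"
    using source.cmp_assoc [OF t(2) t2(2) s(1)]
      source.cmp_assoc [OF t(1) t(2) source.cmp_in [OF t2(2) s(1)]] by simp
  also have "\<dots> = Zero C M R"
    unfolding hg using source.cmp_zero_right [OF Mo source.cmp_in [OF t2(2) s(1)]] .
  finally show ?thesis
    using source.wle_retract [OF L source.retract_left_if_zero [OF d]] by blast
qed

text \<open>In the dual argument L has weight \<open>i\<close> and R -> L[1] becomes a split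
  epimorphism under F. The comparison therefore takes place in weight \<open>i + 1\<close>, with R
  replaced by \<open>L2\<close>, the left part of a weight decomposition of R.\<close>

lemma wge_ascend:
  assumes M: "M \<in> wge C w i"
    and kill: "\<And>N f. N \<in> weq C w i \<Longrightarrow> f \<in> Hom C N M \<Longrightarrow> far F f = Zero D (fob F N) (fob F M)"
  shows "M \<in> wge C w (i + 1)"
proof -
  have Mo: "M \<in> Obj C" using M source.wge_obj by blast
  obtain L R f g h where L: "L \<in> wle C w i" and R: "R \<in> wge C w (i + 1)"
    and d: "(L, M, R, f, g, h) \<in> Dist C"
    using source.weight_decomposition_at [OF Mo] by blast
  have t: "f \<in> Hom C L M" "h \<in> Hom C R (source.sob L)"
    using source.dist_typed [OF d] by auto
  have Leq: "L \<in> weq C w i" using L source.wge_fibre [OF d M R] unfolding weq_def by simp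
  have sL: "source.sob L \<in> weq C w (i + 1)" using Leq source.weq_Suc by blast
  have ob: "L \<in> Obj C" "R \<in> Obj C" "source.sob L \<in> Obj C"
    using source.wge_obj source.weq_obj Leq R sL by auto
  note Fd = dist_image [OF d]
  have Fh: "far F h \<in> Hom D (fob F R) (fob F (source.sob L))" using far_in t by blast
  have iL: "is_iso D (fob F (source.sob L)) (target.sob (fob F L)) (\<eta> L)" using \<eta>_iso [OF ob(1)] .
  then have eL: "\<eta> L \<in> Hom D (fob F (source.sob L)) (target.sob (fob F L))"
    unfolding is_iso_def by blast
  \<comment> \<open>The lifting lemma concerns maps into F(L)[1], so \<open>\<eta> L\<close> is
    lifted in place of an identity. Cancelling it afterwards yields a section of F(h).\<close>
  have "Cmp D (target.sar (far F f)) (\<eta> L) = Zero D (fob F (source.sob L)) (target.sob (fob F M))"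
    using kill [OF Leq t(1)] target.shift.far_zero target.cmp_zero_left [OF eL]
      target.shift.fob_in fob_in ob Mo by simp
  then obtain r where r: "r \<in> Hom D (fob F (source.sob L)) (fob F R)"
      "Cmp D (Cmp D (\<eta> L) (far F h)) r = \<eta> L"
    using target.dist_shift_lift [OF Fd eL] by blast
  have "Cmp D (\<eta> L) (Cmp D (far F h) r) = Cmp D (\<eta> L) (Ident D (fob F (source.sob L)))"
    using r(2) target.cmp_assoc [OF r(1) Fh eL] target.ident_right [OF eL] by simp
  then have hr: "Cmp D (far F h) r = Ident D (fob F (source.sob L))"
    using target.is_iso_cancel_left [OF iL target.cmp_in [OF r(1) Fh]] target.ident_in fob_in ob(3)
    by blast
  obtain L2 R2 f2 g2 h2 where L2: "L2 \<in> wle C w (i + 1)" and R2: "R2 \<in> wge C w (i + 1 + 1)"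
    and d2: "(L2, R, R2, f2, g2, h2) \<in> Dist C"
    using source.weight_decomposition_at [OF ob(2)] by blast
  have t2: "f2 \<in> Hom C L2 R" "g2 \<in> Hom C R R2"
    using source.dist_typed [OF d2] by auto
  have L2eq: "L2 \<in> weq C w (i + 1)" using L2 source.wge_fibre [OF d2 R R2] unfolding weq_def by simp
  have "fob F (source.sob L) \<in> wle D w' (i + 1)" using image_wle sL unfolding weq_def by blast
  \<comment> \<open>F(L[1]) has weights at most \<open>i + 1\<close> and F(R2) at least
    \<open>i + 2\<close>, so the section \<open>r\<close> lifts to F(L2).\<close>
  then have "Cmp D (far F g2) r = Zero D (fob F (source.sob L)) (fob F R2)"
    using target.wle_wge_hom_trivial [OF _ image_wge [OF R2]]
      target.cmp_in [OF r(1) far_in [OF t2(2)]] by blast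
  then obtain c where c: "c \<in> Hom D (fob F (source.sob L)) (fob F L2)" "Cmp D (far F f2) c = r"
    using target.dist_lift [OF dist_image [OF d2] r(1)] by blast
  have "Cmp D (far F (Cmp C h f2)) c = Ident D (fob F (source.sob L))"
    using far_cmp [OF t2(1) t(2)] target.cmp_assoc [OF c(1) far_in [OF t2(1)] Fh] c(2) hr by simp
  then obtain s where s: "s \<in> Hom C (source.sob L) L2" "Cmp C (Cmp C h f2) s = Ident C (source.sob L)"
    using split_epi_at [OF sL L2eq source.cmp_in [OF t2(1) t(2)] c(1)] by blast
  have sf: "source.sar f \<in> Hom C (source.sob L) (source.sob M)"
    using source.shift.far_in t(1) by blast
  \<comment> \<open>Now \<open>h\<close> has a section, while f[1] after \<open>h\<close> is zero;
    hence f[1], and with it \<open>f\<close>, is zero.\<close>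
  have "source.sar f = Cmp C (source.sar f) (Cmp C (Cmp C h f2) s)"
    using s source.ident_right [OF sf] by simp
  also have "\<dots> = Cmp C (Cmp C (source.sar f) h) (Cmp C f2 s)"
    using source.cmp_assoc [OF s(1) t2(1) t(2)]
      source.cmp_assoc [OF source.cmp_in [OF s(1) t2(1)] t(2) sf] by simp
  also have "\<dots> = Zero C (source.sob L) (source.sob M)"
    using source.dist_shift_cmp_zero [OF d] source.cmp_zero_left [OF source.cmp_in [OF s(1) t2(1)]]
      source.shift.fob_in [OF Mo] by simp
  finally have "source.sar f = source.sar (Zero C L M)" using source.shift.far_zero ob Mo by simp
  then have "f = Zero C L M"
    using source.shift_faithful [OF t(1) source.zero_in] ob Mo by blast
  then show ?thesis
    using source.wge_retract [OF R source.retract_right_if_zero [OF d]] by blast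
qed

section \<open>Reflection of weight bounds and degeneracy\<close>

lemma wle_reflect:
  assumes "M \<in> wle C w j" "fob F M \<in> wle D w' n"
  shows "M \<in> wle C w n"
proof (cases "j \<le> n")
  case True
  then show ?thesis using assms source.wle_mono by blast
next
  case False
  have "M \<in> wle C w i" if "n \<le> i" "i \<le> j" for i
    using that(2,1)
  proof (induction rule: int_le_induct)
    case (step i)
    have "M \<in> wle C w i" using step by simp
    then show ?case
    proof (rule wle_descend)
      fix N g assume N: "N \<in> weq C w i" and g: "g \<in> Hom C M N"
      \<comment> \<open>The step goes from \<open>i\<close> to \<open>i - 1\<close>, which is still
        at least \<open>n\<close>. Orthogonality between F(M) and F(N) then gives the hypothesis of
        \<open>wle_descend\<close>.\<close>
      have "fob F M \<in> wle D w' (i - 1)" using assms(2) target.wle_mono step(3) by blast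
      moreover have "fob F N \<in> wge D w' (i - 1 + 1)" using image_wge N unfolding weq_def by auto
      ultimately show "far F g = Zero D (fob F M) (fob F N)"
        using target.wle_wge_hom_trivial far_in [OF g] by blast
    qed
  qed (rule assms)
  then show ?thesis using False by simp
qed

lemma wge_reflect:
  assumes "M \<in> wge C w j" "fob F M \<in> wge D w' n"
  shows "M \<in> wge C w n"
proof (cases "n \<le> j")
  case True
  then show ?thesis using assms source.wge_antimono by blast
next
  case False
  then have "j \<le> n" by simp
  then show ?thesis
    using assms(2)
  proof (induction rule: int_ge_induct)
    case (step i)
    have i: "fob F M \<in> wge D w' (i + 1)" using step by simp
    \<comment> \<open>The bound on F(M) is part of the inductive statement: the bound at
      \<open>i + 1\<close> implies the one at \<open>i\<close>, which feeds the induction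
      hypothesis.\<close>
    have "M \<in> wge C w i" using step target.wge_Suc_subset by blast
    then show ?case
    proof (rule wge_ascend)
      fix N f assume N: "N \<in> weq C w i" and f: "f \<in> Hom C N M"
      have "fob F N \<in> wle D w' i" using image_wle N unfolding weq_def by auto
      then show "far F f = Zero D (fob F N) (fob F M)"
        using target.wle_wge_hom_trivial [OF _ i] far_in [OF f] by blast
    qed
  qed (rule assms)
qed

text \<open>The condition \<open>kill\<close> is imposed at every upper bound of M, so it remains
  available at each new bound reached by \<open>wle_descend\<close>.\<close>

lemma right_degenerate_if_kill:
  assumes M: "M \<in> wle C w j"
    and kill: "\<And>i N g. M \<in> wle C w i \<Longrightarrow> N \<in> weq C w i \<Longrightarrow> g \<in> Hom C M N \<Longrightarrow>
      far F g = Zero D (fob F M) (fob F N)"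
  shows "right_degenerate C w M"
proof -
  have "M \<in> wle C w i" for i
  proof (cases "j \<le> i")
    case True
    then show ?thesis using M source.wle_mono by blast
  next
    case False
    then have "i \<le> j" by simp
    then show ?thesis
      by (induction rule: int_le_induct) (use M wle_descend kill in blast)+
  qed
  then show ?thesis unfolding right_degenerate_def by blast
qed

end

theorem theorem1p5p1:
  fixes C :: "('o, 'm) tricat" and w :: "'o weight"
    and C' :: "('p, 'q) tricat" and w' :: "'p weight"
    and F :: "('o, 'm, 'p, 'q) func" and \<eta> :: "'o \<Rightarrow> 'q"
    and M :: 'o and n :: int
  assumes "triangulated_category C" and "triangulated_category C'"
    and "weight_structure C w" and "weight_structure C' w'"
    and "weight_exact_functor C w C' w' F \<eta>"
    and "full_functor (heart C w) (heart C' w') F"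
    and "conservative_functor (heart C w) (heart C' w') F"
    and "M \<in> Obj C"
  shows "(bounded_above C w M \<longrightarrow> (fob F M \<in> wle C' w' n \<longleftrightarrow> M \<in> wle C w n)) \<and>
    (bounded_below C w M \<longrightarrow> (fob F M \<in> wge C' w' n \<longleftrightarrow> M \<in> wge C w n)) \<and>
    (bounded_above C w M \<and> is_zero_object C' (fob F M) \<longrightarrow> right_degenerate C w M) \<and>
    (bounded_below C w M \<and> is_zero_object C' (fob F M) \<longrightarrow> left_degenerate C w M) \<and>
    (w_bounded C w M \<and> is_zero_object C' (fob F M) \<longrightarrow> is_zero_object C M) \<and>
    (bounded_above C w M \<and>
      (\<forall>i. M \<in> wle C w i \<longrightarrow>
        (\<forall>N \<in> weq C w i. \<forall>f \<in> Hom C M N. far F f = Zero C' (fob F M) (fob F N))) \<longrightarrow>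
      right_degenerate C w M)"
proof -
  interpret heart_full_conservative C w C' w' F \<eta>
    using assms(5-7) by (simp add: heart_full_conservative_def heart_full_conservative_axioms_def)
  have le: "fob F M \<in> wle C' w' k \<longleftrightarrow> M \<in> wle C w k" if "bounded_above C w M" for k
    using that wle_reflect image_wle unfolding bounded_above_def by blast
  have ge: "fob F M \<in> wge C' w' k \<longleftrightarrow> M \<in> wge C w k" if "bounded_below C w M" for k
    using that wge_reflect image_wge unfolding bounded_below_def by blast
  \<comment> \<open>A zero object lies in every class of the target, so reflection applies at all
    levels.\<close>
  have right: "M \<in> wle C w k" if "bounded_above C w M" "is_zero_object C' (fob F M)" for k
    using le that target.zero_object_wle by blast
  have left: "M \<in> wge C w k" if "bounded_below C w M" "is_zero_object C' (fob F M)" for k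
    using ge that target.zero_object_wge by blast
  \<comment> \<open>Weights at most 0 and at least 1 make the identity of M zero by
    orthogonality.\<close>
  have "is_zero_object C M" if "w_bounded C w M" "is_zero_object C' (fob F M)"
    using that right [of 0] left [of "0 + 1"] source.bounded_degenerate_zero
    unfolding w_bounded_def by blast
  moreover have "right_degenerate C w M"
    if "bounded_above C w M" "\<forall>i. M \<in> wle C w i \<longrightarrow>
        (\<forall>N \<in> weq C w i. \<forall>f \<in> Hom C M N. far F f = Zero C' (fob F M) (fob F N))"
    using that right_degenerate_if_kill unfolding bounded_above_def by blast
  ultimately show ?thesis
    using le ge right left unfolding right_degenerate_def left_degenerate_def by blast
qed

end
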